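(* The composition $(\alpha,g,s)(\beta,h,t)=(\alpha\beta,\ \mathbf{g}_{\alpha,g;\beta,h},\ s+t+\mathbf{b}_{\alpha,g;\beta,h})$ of composable arrows is associative in $\overline{2\mathfrak{Cob}}$.
   Context: Notation: $[n]=\{1,\dots,n\}$ for $n\in\mathbb N_0$. A partition $\alpha:[m]\leadsto[n]$ is a set partition of the disjoint union $[m]\sqcup[n]$. For $\alpha:[\ell]\leadsto[m]$ and $\beta:[m]\leadsto[n]$, let $(\alpha\cup\beta)^t$ be the partition of $[\ell]\sqcup[m]\sqcup[n]$ generated by $\alpha$ (on the first two components) and $\beta$ (on the last two); the product $\alpha\beta:[\ell]\leadsto[n]$ is its restriction to $[\ell]\sqcup[n]$. A dead block is a block of $(\alpha\cup\beta)^t$ contained in the middle component $[m]$. $\overline{2\mathfrak{Cob}}$ has object set $\mathbb N_0$; arrows $m\to n$ are all triples $(\alpha,g,s)$ where $\alpha:[m]\leadsto[n]$ is a partition, $g$ is a function from the set of blocks of $\alpha$ to $\mathbb Z$, and $s\in\bigoplus_{i\in\mathbb Z}\mathbb Z$ is a bi-infinite integer sequence with finitely many non-zero entries. For $(\alpha,g,s):\ell\to m$ and $(\beta,h,t):m\to n$: a block $C$ of $(\alpha\cup\beta)^t$ that is the union of the blocks $A_1,\dots,A_a$ of $\alpha$ and $B_1,\dots,B_b$ of $\beta$ and contains exactly $v$ elements of the middle component $[m]$ has label $\mathbf g_{\alpha,g;\beta,h}(C)=\sum_i g(A_i)+\sum_j h(B_j)+v-(a+b)+1$; the value of $\mathbf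 g_{\alpha,g;\beta,h}$ at a block of $\alpha\beta$ is the label of the block of $(\alpha\cup\beta)^t$ containing it; $\mathbf b_{\alpha,g;\beta,h}=(b_i)_{i\in\mathbb Z}$, where $b_i$ is the number of dead blocks with label $i$. *)

theory Defs
  imports Main "HOL-Library.Disjoint_Sets" "HOL-Library.FuncSet" "HOL-Library.Poly_Mapping"
begin

abbreviation interval :: "nat \<Rightarrow> nat set" where
  "interval n \<equiv> {1..n}"

text \<open>A partition of the disjoint union of \<open>[m]\<close> and \<open>[n]\<close>; the summands of
  \<^typ>\<open>nat + nat\<close> keep the two copies apart.\<close>

definition is_partition :: "nat \<Rightarrow> nat \<Rightarrow> (nat + nat) set set \<Rightarrow> bool" where
  "is_partition m n \<alpha> \<longleftrightarrow> partition_on (interval m <+> interval n) \<alpha>"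

definition triple_sum :: "nat \<Rightarrow> nat \<Rightarrow> nat \<Rightarrow> (nat + nat + nat) set" where
  "triple_sum l m n = interval l <+> (interval m <+> interval n)"

text \<open>Inclusions of the first two, last two, and outer two components into the triple
  disjoint union.\<close>

definition emb12 :: "nat + nat \<Rightarrow> nat + nat + nat" where
  "emb12 = map_sum id Inl"

definition emb23 :: "nat + nat \<Rightarrow> nat + nat + nat" where
  "emb23 = Inr"

definition emb13 :: "nat + nat \<Rightarrow> nat + nat + nat" where
  "emb13 = map_sum id Inr"

definition middle :: "nat \<Rightarrow> (nat + nat + nat) set" where
  "middle m = (Inr \<circ> Inl) ` interval m"

text \<open>The partition of the triple disjoint union generated by \<open>\<alpha>\<close> and \<open>\<beta>\<close>: the classes of the
  least equivalence relation under which each block of \<open>\<alpha>\<close> and of \<open>\<beta>\<close> lies in a single class.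
  The relation being closed is already symmetric, and reflexive on the triple disjoint union,
  because the blocks of \<open>\<alpha>\<close> and \<open>\<beta>\<close> cover it.\<close>

definition gen_rel ::
  "(nat + nat) set set \<Rightarrow> (nat + nat) set set \<Rightarrow> (nat + nat + nat) rel" where
  "gen_rel \<alpha> \<beta> = ((\<Union>A\<in>\<alpha>. emb12 ` A \<times> emb12 ` A) \<union> (\<Union>B\<in>\<beta>. emb23 ` B \<times> emb23 ` B))\<^sup>+"

definition gen_partition ::
  "nat \<Rightarrow> nat \<Rightarrow> nat \<Rightarrow> (nat + nat) set set \<Rightarrow> (nat + nat) set set \<Rightarrow> (nat + nat + nat) set set" where
  "gen_partition l m n \<alpha> \<beta> = triple_sum l m n // gen_rel \<alpha> \<beta>"

definition part_prod ::
  "nat \<Rightarrow> nat \<Rightarrow> nat \<Rightarrow> (nat + nat) set set \<Rightarrow> (nat + nat) set set \<Rightarrow> (nat + nat) set set" where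
  "part_prod l m n \<alpha> \<beta> = (\<lambda>C. emb13 -` C) ` gen_partition l m n \<alpha> \<beta> - {{}}"

definition dead_blocks ::
  "nat \<Rightarrow> nat \<Rightarrow> nat \<Rightarrow> (nat + nat) set set \<Rightarrow> (nat + nat) set set \<Rightarrow> (nat + nat + nat) set set" where
  "dead_blocks l m n \<alpha> \<beta> = {C \<in> gen_partition l m n \<alpha> \<beta>. C \<subseteq> middle m}"

text \<open>An arrow \<open>m \<rightarrow> n\<close> is a triple \<open>(\<alpha>, g, s)\<close>. A function on the set of blocks is encoded as a
  function on all sets that is \<^const>\<open>undefined\<close> off \<open>\<alpha>\<close>, so that equality of triples is
  equality of arrows.\<close>

type_synonym arrow = "(nat + nat) set set \<times> ((nat + nat) set \<Rightarrow> int) \<times> (int \<Rightarrow>\<^sub>0 int)"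

definition Hom :: "nat \<Rightarrow> nat \<Rightarrow> arrow set" where
  "Hom m n = {(\<alpha>, g, s). is_partition m n \<alpha> \<and> g \<in> \<alpha> \<rightarrow>\<^sub>E UNIV}"

definition block_label ::
  "nat \<Rightarrow> (nat + nat) set set \<Rightarrow> ((nat + nat) set \<Rightarrow> int) \<Rightarrow>
   (nat + nat) set set \<Rightarrow> ((nat + nat) set \<Rightarrow> int) \<Rightarrow> (nat + nat + nat) set \<Rightarrow> int" where
  "block_label m \<alpha> g \<beta> h C =
    (let As = {A \<in> \<alpha>. emb12 ` A \<subseteq> C}; Bs = {B \<in> \<beta>. emb23 ` B \<subseteq> C}; v = card (C \<inter> middle m)
     in (\<Sum>A\<in>As. g A) + (\<Sum>B\<in>Bs. h B) + int v - int (card As + card Bs) + 1)"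

definition g_comp ::
  "nat \<Rightarrow> nat \<Rightarrow> nat \<Rightarrow> (nat + nat) set set \<Rightarrow> ((nat + nat) set \<Rightarrow> int) \<Rightarrow>
   (nat + nat) set set \<Rightarrow> ((nat + nat) set \<Rightarrow> int) \<Rightarrow> (nat + nat) set \<Rightarrow> int" where
  "g_comp l m n \<alpha> g \<beta> h =
    (\<lambda>D\<in>part_prod l m n \<alpha> \<beta>.
       block_label m \<alpha> g \<beta> h (THE C. C \<in> gen_partition l m n \<alpha> \<beta> \<and> emb13 ` D \<subseteq> C))"

lemma finite_dead_blocks: "finite (dead_blocks l m n \<alpha> \<beta>)"
  by (simp add: dead_blocks_def gen_partition_def triple_sum_def quotient_def)

lift_definition b_comp ::
  "nat \<Rightarrow> nat \<Rightarrow> nat \<Rightarrow> (nat + nat) set set \<Rightarrow> ((nat + nat) set \<Rightarrow> int) \<Rightarrow>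
   (nat + nat) set set \<Rightarrow> ((nat + nat) set \<Rightarrow> int) \<Rightarrow> (int \<Rightarrow>\<^sub>0 int)" is
  "\<lambda>l m n \<alpha> g \<beta> h i. int (card {C \<in> dead_blocks l m n \<alpha> \<beta>. block_label m \<alpha> g \<beta> h C = i})"
proof -
  fix l m n \<alpha> g \<beta> h
  have "{i. int (card {C \<in> dead_blocks l m n \<alpha> \<beta>. block_label m \<alpha> g \<beta> h C = i}) \<noteq> 0}
      \<subseteq> block_label m \<alpha> g \<beta> h ` dead_blocks l m n \<alpha> \<beta>"
    by (auto simp: card_eq_0_iff)
  then show "finite {i. int (card {C \<in> dead_blocks l m n \<alpha> \<beta>. block_label m \<alpha> g \<beta> h C = i}) \<noteq> 0}"
    by (rule finite_subset) (simp add: finite_dead_blocks)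
qed

text \<open>Composition is written in diagrammatic order: the first arrow goes \<open>l \<rightarrow> m\<close>, the second
  \<open>m \<rightarrow> n\<close>.\<close>

definition cob_comp :: "nat \<Rightarrow> nat \<Rightarrow> nat \<Rightarrow> arrow \<Rightarrow> arrow \<Rightarrow> arrow" where
  "cob_comp l m n = (\<lambda>(\<alpha>, g, s) (\<beta>, h, t).
     (part_prod l m n \<alpha> \<beta>, g_comp l m n \<alpha> g \<beta> h, s + t + b_comp l m n \<alpha> g \<beta> h))"

lemma equiv_gen_rel:
  assumes "is_partition l m \<alpha>" "is_partition m n \<beta>"
  shows "equiv (triple_sum l m n) (gen_rel \<alpha> \<beta>)"
proof -
  let ?X = "triple_sum l m n"
  let ?r = "(\<Union>A\<in>\<alpha>. emb12 ` A \<times> emb12 ` A) \<union> (\<Union>B\<in>\<beta>. emb23 ` B \<times> emb23 ` B)"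
  have a: "\<Union>\<alpha> = interval l <+> interval m" and b: "\<Union>\<beta> = interval m <+> interval n"
    using assms by (auto simp: is_partition_def partition_on_def)
  have im1: "emb12 ` (interval l <+> interval m) \<subseteq> ?X"
    and im2: "emb23 ` (interval m <+> interval n) \<subseteq> ?X"
    by (auto simp: triple_sum_def emb12_def emb23_def)
  have cov: "?X \<subseteq> emb12 ` (interval l <+> interval m) \<union> emb23 ` (interval m <+> interval n)"
  proof
    fix x assume "x \<in> ?X"
    then consider y where "x = Inl y" "y \<in> interval l" | y where "x = Inr y" "y \<in> interval m <+> interval n"
      unfolding triple_sum_def by blast
    then show "x \<in> emb12 ` (interval l <+> interval m) \<union> emb23 ` (interval m <+> interval n)"
    proof cases
      case 1
      then have "x = emb12 (Inl y)" "Inl y \<in> interval l <+> interval m" by (auto simp: emb12_def)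
      then show ?thesis by blast
    next
      case 2
      then show ?thesis by (simp add: emb23_def)
    qed
  qed
  have sub: "?r \<subseteq> ?X \<times> ?X"
  proof (rule Un_least)
    show "(\<Union>A\<in>\<alpha>. emb12 ` A \<times> emb12 ` A) \<subseteq> ?X \<times> ?X"
      using im1 unfolding a[symmetric] by (intro UN_least Sigma_mono) auto
    show "(\<Union>B\<in>\<beta>. emb23 ` B \<times> emb23 ` B) \<subseteq> ?X \<times> ?X"
      using im2 unfolding b[symmetric] by (intro UN_least Sigma_mono) auto
  qed
  have rf: "(x, x) \<in> ?r" if "x \<in> ?X" for x
  proof -
    from that cov consider y where "y \<in> \<Union>\<alpha>" "x = emb12 y" | y where "y \<in> \<Union>\<beta>" "x = emb23 y"
      unfolding a b by blast
    then show ?thesis by cases auto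
  qed
  have sym: "sym ?r" by (intro symI) auto
  show ?thesis
    unfolding gen_rel_def
  proof (rule equivI)
    show "?r\<^sup>+ \<subseteq> ?X \<times> ?X" using trancl_subset_Sigma[OF sub] .
    show "refl_on ?X (?r\<^sup>+)" by (rule refl_onI) (rule r_into_trancl[OF rf])
    show "sym (?r\<^sup>+)" by (rule sym_trancl[OF sym])
    show "trans (?r\<^sup>+)" by (rule trans_trancl)
  qed
qed

lemma cob_comp_in_Hom:
  assumes "f \<in> Hom l m" "f' \<in> Hom m n"
  shows "cob_comp l m n f f' \<in> Hom l n"
proof -
  obtain \<alpha> g s \<beta> h t where f: "f = (\<alpha>, g, s)" "f' = (\<beta>, h, t)"
    by (cases f, cases f') auto
  have p: "is_partition l m \<alpha>" "is_partition m n \<beta>"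
    using assms by (auto simp: f Hom_def)
  have gp: "partition_on (triple_sum l m n) (gen_partition l m n \<alpha> \<beta>)"
    unfolding gen_partition_def by (rule partition_on_quotient[OF equiv_gen_rel[OF p]])
  have "emb13 -` triple_sum l m n = interval l <+> interval n"
  proof (rule set_eqI)
    fix x show "x \<in> emb13 -` triple_sum l m n \<longleftrightarrow> x \<in> interval l <+> interval n"
      by (cases x) (auto simp: emb13_def triple_sum_def)
  qed
  moreover have "partition_on (emb13 -` triple_sum l m n) (part_prod l m n \<alpha> \<beta>)"
    using gp unfolding part_prod_def by (rule partition_on_vimage)
  ultimately have "is_partition l n (part_prod l m n \<alpha> \<beta>)"
    by (simp add: is_partition_def)
  then show ?thesis
    by (simp add: f cob_comp_def Hom_def g_comp_def)
qed

end

theory Submission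
  imports Defs
begin

text \<open>
  Put all four objects \<open>k, l, m, n\<close> side by side in one disjoint union, on which the blocks of the
  three arrows become subsets. Both bracketings then describe the same thing: the connected
  components of all these blocks together, with the points of \<open>[l]\<close> and \<open>[m]\<close> hidden. The
  bracketing only decides whether \<open>[l]\<close> or \<open>[m]\<close> is hidden first, and this cannot matter. When
  \<open>[l]\<close> is hidden after the first two arrows are glued, each point of \<open>[l]\<close> lies in only one of the
  remaining pieces, so removing it disconnects nothing (\<open>components_hide\<close>). Whatever disappears
  altogether in this step is a component inside \<open>[l]\<close>, which the third arrow does not touch and
  which is therefore already a component of the whole picture (\<open>components_inside_hidden\<close>).

  The labels become transparent after subtracting \<open>1\<close> from each of them. The label of a glued block
  is \<open>\<Sum>g + \<Sum>h + v - (a + b) + 1\<close>; lowered by \<open>1\<close>, it is the sum of the lowered labels of the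
  constituents plus the number \<open>v\<close> of hidden points (\<open>weight\<close>). For genera of surfaces this is
  the additivity of the Euler characteristic. Summing in two stages therefore gives the same as summing
  over all blocks of the three arrows and all points of \<open>[l]\<close> and \<open>[m]\<close> at once
  (\<open>weight_sum_components\<close>).

  The relation \<open>glues V F X\<close> says that gluing the labelled partitions in the list \<open>F\<close> and then
  hiding \<open>V\<close> gives \<open>X\<close>. Lemma \<open>glues_assoc\<close> turns gluing in two stages into gluing at once, and
  \<open>dead_count_assoc\<close> does the same for the dead blocks. Since gluing at once is symmetric in
  its factors, these lemmas serve for both bracketings, with the factors permuted for the second.
\<close>

section \<open>Connected components of a family of sets\<close>

definition saturated :: "'x set set \<Rightarrow> 'x set \<Rightarrow> bool" where
  "saturated \<S> T \<longleftrightarrow> (\<forall>S\<in>\<S>. S \<subseteq> T \<or> S \<inter> T = {})"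

text \<open>The classes of the finest partition for which every member of \<open>\<S>\<close> lies in a single class.
  Describing them as the indivisible saturated sets, rather than through a generated equivalence
  relation, replaces arguments about paths by the choice of a suitable saturated set.\<close>

definition components :: "'x set set \<Rightarrow> 'x set set" where
  "components \<S> = {C. C \<noteq> {} \<and> C \<subseteq> \<Union>\<S> \<and> saturated \<S> C \<and>
     (\<forall>T. saturated \<S> T \<longrightarrow> C \<subseteq> T \<or> C \<inter> T = {})}"

lemma saturated_Un: "saturated (\<S> \<union> \<T>) T \<longleftrightarrow> saturated \<S> T \<and> saturated \<T> T"
  by (auto simp: saturated_def)

lemma saturated_Int: "saturated \<S> T \<Longrightarrow> saturated \<S> U \<Longrightarrow> saturated \<S> (T \<inter> U)"
  unfolding saturated_def by blast

lemma saturated_disjoint: "T \<inter> \<Union>\<S> = {} \<Longrightarrow> saturated \<S> T"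
  unfolding saturated_def by blast

lemma componentsD:
  assumes "C \<in> components \<S>"
  shows "C \<noteq> {}" "C \<subseteq> \<Union>\<S>" "saturated \<S> C" "saturated \<S> T \<Longrightarrow> C \<subseteq> T \<or> C \<inter> T = {}"
  using assms by (simp_all add: components_def)

lemma components_disjoint:
  assumes "C \<in> components \<S>" "D \<in> components \<S>" "x \<in> C" "x \<in> D"
  shows "C = D"
  using assms unfolding components_def by blast

lemma quotient_subset_components:
  "\<Union>\<S> // (\<Union>S\<in>\<S>. S \<times> S)\<^sup>+ \<subseteq> components \<S>"
proof
  let ?r = "\<Union>S\<in>\<S>. S \<times> S"
  fix C assume "C \<in> \<Union>\<S> // ?r\<^sup>+"
  then obtain x where x: "x \<in> \<Union>\<S>" and C: "C = ?r\<^sup>+ `` {x}"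
    by (rule quotientE)
  have xC: "x \<in> C" using x by (auto simp: C intro!: r_into_trancl)
  have fld: "?r\<^sup>+ \<subseteq> \<Union>\<S> \<times> \<Union>\<S>" by (rule trancl_subset_Sigma) auto
  have "saturated \<S> C"
    unfolding saturated_def
  proof (intro ballI)
    fix S assume S: "S \<in> \<S>"
    show "S \<subseteq> C \<or> S \<inter> C = {}"
    proof (cases "S \<inter> C = {}")
      case False
      then obtain y where y: "y \<in> S" "(x, y) \<in> ?r\<^sup>+" by (auto simp: C)
      have "(x, z) \<in> ?r\<^sup>+" if "z \<in> S" for z
        using y that S by (blast intro: trancl_into_trancl)
      then show ?thesis by (auto simp: C)
    qed simp
  qed
  moreover have "C \<subseteq> T \<or> C \<inter> T = {}" if T: "saturated \<S> T" for T
  proof -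
    have "y \<in> T \<longleftrightarrow> x \<in> T" if "(x, y) \<in> ?r\<^sup>+" for y
      using that
    proof induction
      case (base y)
      then show ?case using T unfolding saturated_def by blast
    next
      case (step y z)
      then show ?case using T unfolding saturated_def by blast
    qed
    then show ?thesis by (auto simp: C)
  qed
  ultimately show "C \<in> components \<S>"
    using xC fld by (auto simp: components_def C)
qed

text \<open>Components are pairwise disjoint, so a set of them that covers everything omits none.\<close>

lemma components_eqI:
  assumes "\<D> \<subseteq> components \<S>" "\<Union>\<S> \<subseteq> \<Union>\<D>"
  shows "components \<S> = \<D>"
proof
  show "components \<S> \<subseteq> \<D>"
  proof
    fix C assume C: "C \<in> components \<S>"
    then obtain x where "x \<in> C" "x \<in> \<Union>\<S>" unfolding components_def by blast
    moreover from this assms obtain D where "D \<in> \<D>" "x \<in> D" by blast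
    ultimately show "C \<in> \<D>" using components_disjoint[OF C] assms(1) by blast
  qed
qed fact

lemma Union_quotient_trancl: "\<Union>\<S> \<subseteq> \<Union>(\<Union>\<S> // (\<Union>S\<in>\<S>. S \<times> S)\<^sup>+)"
proof
  fix x assume x: "x \<in> \<Union>\<S>"
  then have "x \<in> (\<Union>S\<in>\<S>. S \<times> S)\<^sup>+ `` {x}" by auto
  with quotientI[OF x] show "x \<in> \<Union>(\<Union>\<S> // (\<Union>S\<in>\<S>. S \<times> S)\<^sup>+)" by blast
qed

lemma components_eq_quotient: "components \<S> = \<Union>\<S> // (\<Union>S\<in>\<S>. S \<times> S)\<^sup>+"
  by (rule components_eqI[OF quotient_subset_components Union_quotient_trancl])

lemma Union_components: "\<Union>(components \<S>) = \<Union>\<S>"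
proof
  show "\<Union>(components \<S>) \<subseteq> \<Union>\<S>" by (auto simp: components_def)
  show "\<Union>\<S> \<subseteq> \<Union>(components \<S>)"
    unfolding components_eq_quotient by (rule Union_quotient_trancl)
qed

lemma component_of_member:
  assumes "S \<in> \<S>" "S \<noteq> {}"
  obtains C where "C \<in> components \<S>" "S \<subseteq> C"
proof -
  obtain x where x: "x \<in> S" using assms by blast
  then obtain C where C: "C \<in> components \<S>" "x \<in> C"
    using Union_components[of \<S>] assms by blast
  then have "S \<subseteq> C" using assms x unfolding components_def saturated_def by blast
  with C that show ?thesis by blast
qed

lemma saturated_components_iff: "saturated (components \<S>) T \<longleftrightarrow> saturated \<S> T"
proof
  assume T: "saturated (components \<S>) T"
  show "saturated \<S> T"
    unfolding saturated_def
  proof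
    fix S assume S: "S \<in> \<S>"
    show "S \<subseteq> T \<or> S \<inter> T = {}"
    proof (cases "S = {}")
      case False
      with S obtain C where "C \<in> components \<S>" "S \<subseteq> C" by (rule component_of_member)
      then show ?thesis using T unfolding saturated_def by blast
    qed simp
  qed
qed (auto simp: saturated_def components_def)

text \<open>Connecting in stages is the same as connecting at once, because both families have the same
  saturated sets.\<close>

lemma components_components_Un: "components (components \<S> \<union> \<T>) = components (\<S> \<union> \<T>)"
proof -
  have "saturated (components \<S> \<union> \<T>) T \<longleftrightarrow> saturated (\<S> \<union> \<T>) T" for T
    using saturated_components_iff[of \<S> T] unfolding saturated_def by blast
  then show ?thesis
    by (simp add: components_def[of "components \<S> \<union> \<T>"] components_def[of "\<S> \<union> \<T>"]
        Union_components)
qed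

lemma components_image:
  assumes "inj j"
  shows "components ((`) j ` \<S>) = (`) j ` components \<S>"
proof (rule components_eqI)
  show "(`) j ` components \<S> \<subseteq> components ((`) j ` \<S>)"
  proof (rule image_subsetI)
    fix C assume C: "C \<in> components \<S>"
    have "saturated ((`) j ` \<S>) (j ` C)"
      unfolding saturated_def
    proof (intro ballI, elim imageE)
      fix U S assume S: "S \<in> \<S>" and U: "U = j ` S"
      then have "S \<subseteq> C \<or> S \<inter> C = {}" using C unfolding components_def saturated_def by blast
      then show "U \<subseteq> j ` C \<or> U \<inter> j ` C = {}"
        unfolding U image_Int[OF assms, symmetric] by blast
    qed
    moreover have "j ` C \<subseteq> T \<or> j ` C \<inter> T = {}" if "saturated ((`) j ` \<S>) T" for T
    proof -
      have "saturated \<S> (j -` T)"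
        unfolding saturated_def
      proof
        fix S assume "S \<in> \<S>"
        then have "j ` S \<subseteq> T \<or> j ` S \<inter> T = {}" using that by (simp add: saturated_def)
        then show "S \<subseteq> j -` T \<or> S \<inter> j -` T = {}" by blast
      qed
      then have "C \<subseteq> j -` T \<or> C \<inter> j -` T = {}"
        using C unfolding components_def by blast
      then show ?thesis by blast
    qed
    ultimately show "j ` C \<in> components ((`) j ` \<S>)"
      using C by (simp add: components_def image_Union[symmetric] image_mono)
  qed
  show "\<Union>((`) j ` \<S>) \<subseteq> \<Union>((`) j ` components \<S>)"
    using Union_components[of \<S>] by blast
qed

text \<open>A point that lies in a single member of the family does not connect that member to others, so
  it can be deleted before or after forming components. The assumption is indispensable: two sets that
  meet only in \<open>V\<close> fall apart when \<open>V\<close> is deleted first.\<close>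

lemma components_hide:
  assumes only: "\<And>S S' x. S \<in> \<S> \<Longrightarrow> S' \<in> \<S> \<Longrightarrow> x \<in> V \<Longrightarrow> x \<in> S \<Longrightarrow> x \<in> S' \<Longrightarrow> S = S'"
  shows "components ((\<lambda>S. S - V) ` \<S> - {{}}) = (\<lambda>C. C - V) ` components \<S> - {{}}"
    (is "components ?\<S> = ?\<D>")
proof (rule components_eqI)
  show "?\<D> \<subseteq> components ?\<S>"
  proof
    fix D assume "D \<in> ?\<D>"
    then obtain C where C: "C \<in> components \<S>" and D: "D = C - V" and ne: "D \<noteq> {}" by blast
    have "saturated ?\<S> D"
      using C unfolding D components_def saturated_def by blast
    moreover have "D \<subseteq> T \<or> D \<inter> T = {}" if T: "saturated ?\<S> T" for T
    proof -
      \<comment> \<open>A saturated set of the full family that agrees with \<open>T\<close> off \<open>V\<close>; on \<open>V\<close>, each point has to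
        follow the only member that contains it.\<close>
      let ?U = "\<Union>{S \<in> \<S>. (S - V) \<inter> T \<noteq> {}}"
      have in_T: "S - V \<subseteq> T" if "S \<in> \<S>" "(S - V) \<inter> T \<noteq> {}" for S
      proof -
        have "S - V \<in> ?\<S>" using that by blast
        with T that show ?thesis unfolding saturated_def by blast
      qed
      have "saturated \<S> ?U"
        unfolding saturated_def
      proof
        fix S assume S: "S \<in> \<S>"
        show "S \<subseteq> ?U \<or> S \<inter> ?U = {}"
        proof (cases "(S - V) \<inter> T = {}")
          case True
          have "x \<notin> ?U" if "x \<in> S" for x
          proof
            assume "x \<in> ?U"
            then obtain S' where S': "S' \<in> \<S>" "(S' - V) \<inter> T \<noteq> {}" "x \<in> S'" by blast
            show False
            proof (cases "x \<in> V")
              case True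
              with only S S' that \<open>(S - V) \<inter> T = {}\<close> show False by blast
            next
              case False
              with in_T S' that True show False by blast
            qed
          qed
          then show ?thesis by blast
        qed (use S in blast)
      qed
      then have "C \<subseteq> ?U \<or> C \<inter> ?U = {}" using C unfolding components_def by blast
      then show ?thesis
      proof
        assume "C \<subseteq> ?U"
        then show ?thesis using in_T unfolding D by blast
      next
        assume "C \<inter> ?U = {}"
        moreover have "C \<subseteq> \<Union>\<S>" using C unfolding components_def by blast
        ultimately have "D \<inter> T = {}" unfolding D by blast
        then show ?thesis ..
      qed
    qed
    moreover have "D \<subseteq> \<Union>?\<S>" using C unfolding D components_def by blast
    ultimately show "D \<in> components ?\<S>" using ne by (simp add: components_def)
  qed
  show "\<Union>?\<S> \<subseteq> \<Union>?\<D>" using Union_components[of \<S>] by blast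
qed

lemma components_inside_hidden:
  assumes V: "V \<inter> \<Union>\<T> = {}" and CV: "C \<subseteq> V"
  shows "C \<in> components (\<S> \<union> \<T>) \<longleftrightarrow> C \<in> components \<S>"
proof
  assume C: "C \<in> components (\<S> \<union> \<T>)"
  have "C \<subseteq> T \<or> C \<inter> T = {}" if "saturated \<S> T" for T
  proof -
    have "C \<inter> T \<inter> \<Union>\<T> = {}" using V CV by blast
    then have "saturated (\<S> \<union> \<T>) (C \<inter> T)"
      using componentsD(3)[OF C] that by (simp add: saturated_Un saturated_Int saturated_disjoint)
    from componentsD(4)[OF C this] show ?thesis by blast
  qed
  moreover have "C \<subseteq> \<Union>\<S>" using componentsD(2)[OF C] V CV by blast
  ultimately show "C \<in> components \<S>"
    using componentsD(1,3)[OF C] by (simp add: components_def saturated_Un)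
next
  assume C: "C \<in> components \<S>"
  have "C \<inter> \<Union>\<T> = {}" using V CV by blast
  then have "saturated \<T> C" by (rule saturated_disjoint)
  moreover have "C \<subseteq> \<Union>(\<S> \<union> \<T>)" using componentsD(2)[OF C] by blast
  ultimately show "C \<in> components (\<S> \<union> \<T>)"
    using componentsD[OF C] by (simp add: components_def saturated_Un)
qed

text \<open>The index set allows the same lemma to sum over the blocks of a partition and, with singletons
  for \<open>S\<close>, to count hidden points.\<close>

lemma sum_over_components:
  fixes f :: "'i \<Rightarrow> int"
  assumes fin: "finite (components \<S>)" "finite I"
    and mem: "\<And>i. i \<in> I \<Longrightarrow> S i \<noteq> {} \<and> (\<exists>C\<in>components \<S>. S i \<subseteq> C)"
    and sat: "saturated \<S> E"
  shows "(\<Sum>C\<in>{C \<in> components \<S>. C \<subseteq> E}. \<Sum>i\<in>{i \<in> I. S i \<subseteq> C}. f i) =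
    (\<Sum>i\<in>{i \<in> I. S i \<subseteq> E}. f i)"
proof -
  let ?K = "{C \<in> components \<S>. C \<subseteq> E}"
  have "(\<Sum>i\<in>(\<Union>C\<in>?K. {i \<in> I. S i \<subseteq> C}). f i) = (\<Sum>C\<in>?K. \<Sum>i\<in>{i \<in> I. S i \<subseteq> C}. f i)"
  proof (rule sum.UNION_disjoint)
    show "\<forall>C\<in>?K. \<forall>D\<in>?K. C \<noteq> D \<longrightarrow> {i \<in> I. S i \<subseteq> C} \<inter> {i \<in> I. S i \<subseteq> D} = {}"
    proof (intro ballI impI)
      fix C D assume CD: "C \<in> ?K" "D \<in> ?K" "C \<noteq> D"
      have "\<not> (S i \<subseteq> C \<and> S i \<subseteq> D)" if "i \<in> I" for i
        using CD mem[OF that] components_disjoint[of C \<S> D] by blast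
      then show "{i \<in> I. S i \<subseteq> C} \<inter> {i \<in> I. S i \<subseteq> D} = {}" by blast
    qed
  qed (use fin in auto)
  moreover have "(\<Union>C\<in>?K. {i \<in> I. S i \<subseteq> C}) = {i \<in> I. S i \<subseteq> E}"
  proof (intro equalityI subsetI)
    fix i assume i: "i \<in> {i \<in> I. S i \<subseteq> E}"
    with mem obtain C where C: "C \<in> components \<S>" "S i \<subseteq> C" "S i \<noteq> {}" by blast
    then have "C \<subseteq> E" using sat i unfolding components_def by blast
    with C i show "i \<in> (\<Union>C\<in>?K. {i \<in> I. S i \<subseteq> C})" by blast
  qed blast
  ultimately show ?thesis by simp
qed

section \<open>Gluing labelled partitions and hiding points\<close>

type_synonym 'x lpart = "'x set set \<times> ('x set \<Rightarrow> int)"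

definition pieces :: "'x lpart list \<Rightarrow> 'x set set" where
  "pieces F = \<Union>(fst ` set F)"

text \<open>The label of a block with the constant \<open>1\<close> absorbed: the labels carried by an
  \<open>lpart\<close> stand for the labels of an arrow minus \<open>1\<close>. This makes \<open>weight\<close> additive.\<close>

definition weight :: "'x set \<Rightarrow> 'x lpart list \<Rightarrow> 'x set \<Rightarrow> int" where
  "weight V F C = (\<Sum>X\<leftarrow>F. \<Sum>A\<in>{A \<in> fst X. A \<subseteq> C}. snd X A) + int (card (C \<inter> V))"

text \<open>This is a relation because only the labels of actual blocks are prescribed; the values that
  the labelling takes elsewhere are left open.\<close>

definition glues :: "'x set \<Rightarrow> 'x lpart list \<Rightarrow> 'x lpart \<Rightarrow> bool" where
  "glues V F X \<longleftrightarrow> fst X = (\<lambda>C. C - V) ` components (pieces F) - {{}} \<and>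
     (\<forall>C\<in>components (pieces F). \<not> C \<subseteq> V \<longrightarrow> snd X (C - V) = weight V F C)"

definition dead_count :: "'x set \<Rightarrow> 'x lpart list \<Rightarrow> int \<Rightarrow> nat" where
  "dead_count V F w = card {C \<in> components (pieces F). C \<subseteq> V \<and> weight V F C = w}"

lemma finite_components: "finite (\<Union>\<S>) \<Longrightarrow> finite (components \<S>)"
  by (rule finite_subset[of _ "Pow (\<Union>\<S>)"]) (auto simp: components_def)

text \<open>Every block and every hidden point inside a saturated set belongs to exactly one of its
  components.\<close>

lemma weight_sum_components:
  assumes fin: "finite (\<Union>(pieces F))" and ne: "{} \<notin> pieces F"
    and V: "V \<subseteq> \<Union>(pieces F)" and sat: "saturated (pieces F) E"
  shows "(\<Sum>C\<in>{C \<in> components (pieces F). C \<subseteq> E}. weight V F C) = weight V F E"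
proof -
  let ?K = "{C \<in> components (pieces F). C \<subseteq> E}"
  have finC: "finite (components (pieces F))" using fin by (rule finite_components)
  have blocks: "(\<Sum>C\<in>?K. \<Sum>X\<leftarrow>G. \<Sum>A\<in>{A \<in> fst X. A \<subseteq> C}. snd X A) =
      (\<Sum>X\<leftarrow>G. \<Sum>A\<in>{A \<in> fst X. A \<subseteq> E}. snd X A)" if "set G \<subseteq> set F" for G
    using that
  proof (induction G)
    case (Cons X G)
    have X: "fst X \<subseteq> pieces F" using Cons.prems by (auto simp: pieces_def)
    have "(\<Sum>C\<in>?K. \<Sum>A\<in>{A \<in> fst X. A \<subseteq> C}. snd X A) = (\<Sum>A\<in>{A \<in> fst X. A \<subseteq> E}. snd X A)"
    proof (rule sum_over_components[OF finC _ _ sat])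
      show "finite (fst X)" using X finite_UnionD[OF fin] by (rule finite_subset)
      show "A \<noteq> {} \<and> (\<exists>C\<in>components (pieces F). A \<subseteq> C)" if "A \<in> fst X" for A
        using that X ne component_of_member[of A "pieces F"] by blast
    qed
    then show ?case using Cons by (simp add: sum.distrib)
  qed simp
  have pts: "int (card (C \<inter> V)) = (\<Sum>x\<in>{x \<in> V. {x} \<subseteq> C}. 1)" for C
    by (simp add: Int_def conj_commute)
  have points: "(\<Sum>C\<in>?K. int (card (C \<inter> V))) = int (card (E \<inter> V))"
    unfolding pts
  proof (rule sum_over_components[OF finC _ _ sat])
    show "finite V" using V fin by (rule finite_subset)
    show "{x} \<noteq> {} \<and> (\<exists>C\<in>components (pieces F). {x} \<subseteq> C)" if "x \<in> V" for x
      using that V Union_components[of "pieces F"] by blast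
  qed
  show ?thesis
    unfolding weight_def sum.distrib points blocks[OF order_refl] ..
qed

text \<open>First \<open>F\<close> is glued to \<open>X\<close> and \<open>L\<close> is hidden, then \<open>X\<close> is glued to \<open>G\<close> and \<open>M\<close> is hidden. The
  points hidden first must not be needed in the second step, hence \<open>L\<close> avoids \<open>G\<close>.\<close>

locale glued_twice =
  fixes L M :: "'x set" and F G :: "'x lpart list" and X :: "'x lpart"
  assumes finF: "finite (\<Union>(pieces F))" and finG: "finite (\<Union>(pieces G))"
    and neF: "{} \<notin> pieces F" and neG: "{} \<notin> pieces G"
    and LF: "L \<subseteq> \<Union>(pieces F)" and LG: "L \<inter> \<Union>(pieces G) = {}" and LM: "L \<inter> M = {}"
    and X: "glues L F X"
begin

lemma pieces_append: "pieces (F @ G) = pieces F \<union> pieces G"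
  by (auto simp: pieces_def)

text \<open>The second step starts from the components of \<open>F\<close> without \<open>L\<close>. By \<open>components_hide\<close>, \<open>L\<close> may
  instead be deleted at the end: each of its points lies in one component of \<open>F\<close> and in no piece
  of \<open>G\<close>.\<close>

lemma components_second_step:
  "components (pieces (X # G)) = (\<lambda>E. E - L) ` components (pieces (F @ G)) - {{}}"
proof -
  let ?\<S> = "components (pieces F) \<union> pieces G"
  have "(\<lambda>S. S - L) ` pieces G = id ` pieces G"
    using LG by (intro image_cong) auto
  then have "(\<lambda>S. S - L) ` ?\<S> - {{}} = pieces (X # G)"
    using X neG by (auto simp: glues_def pieces_def image_Un)
  moreover have "components ((\<lambda>S. S - L) ` ?\<S> - {{}}) = (\<lambda>E. E - L) ` components ?\<S> - {{}}"
    by (rule components_hide) (use LG components_disjoint[of _ "pieces F"] in blast)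
  ultimately show ?thesis
    by (simp add: components_components_Un pieces_append)
qed

lemma diff_inj:
  assumes "E \<in> components \<S>" "E' \<in> components \<S>" "E - L = E' - L" "\<not> E \<subseteq> L"
  shows "E = E'"
  using assms components_disjoint[of E \<S> E'] by blast

lemma components_inside_L:
  "C \<subseteq> L \<Longrightarrow> C \<in> components (pieces (F @ G)) \<longleftrightarrow> C \<in> components (pieces F)"
  unfolding pieces_append by (rule components_inside_hidden[OF LG])

lemma saturated_component:
  "E \<in> components (pieces (F @ G)) \<Longrightarrow> saturated (pieces F) E"
  by (auto simp: components_def saturated_def pieces_append)

text \<open>A component \<open>E\<close> of everything is cut by \<open>F\<close> into components \<open>C\<close>, whose weights have been
  recorded as the labels of the blocks \<open>C - L\<close> of \<open>X\<close>. None of the \<open>C\<close> was lost by being dead, as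
  a dead one would be all of \<open>E\<close>, which reaches outside \<open>L\<close>. So the labels of \<open>X\<close> inside \<open>E - L\<close> sum to the \<open>F\<close>-part of the
  weight of \<open>E\<close>, including the points of \<open>L\<close>.\<close>

lemma weight_second_step:
  assumes E: "E \<in> components (pieces (F @ G))" and EL: "\<not> E \<subseteq> L"
  shows "weight M (X # G) (E - L) = weight (L \<union> M) (F @ G) E"
proof -
  let ?K = "{C \<in> components (pieces F). C \<subseteq> E}"
  have live: "\<not> C \<subseteq> L" if "C \<in> ?K" for C
  proof
    assume "C \<subseteq> L"
    then have C: "C \<in> components (pieces (F @ G))" using components_inside_L[OF \<open>C \<subseteq> L\<close>] that by simp
    then have "C \<noteq> {}" by (simp add: components_def)
    with that components_disjoint[OF C E] have "C = E" by blast
    with \<open>C \<subseteq> L\<close> EL show False by blast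
  qed
  have bij: "bij_betw (\<lambda>C. C - L) ?K {D \<in> fst X. D \<subseteq> E - L}"
  proof (rule bij_betwI')
    show "C - L = C' - L \<longleftrightarrow> C = C'" if "C \<in> ?K" "C' \<in> ?K" for C C'
      using that diff_inj[of C "pieces F" C'] live by blast
    show "C - L \<in> {D \<in> fst X. D \<subseteq> E - L}" if "C \<in> ?K" for C
      using that live[OF that] X by (auto simp: glues_def)
    show "\<exists>C\<in>?K. D = C - L" if "D \<in> {D \<in> fst X. D \<subseteq> E - L}" for D
    proof -
      from that X obtain C where C: "C \<in> components (pieces F)" "D = C - L" "D \<noteq> {}" "D \<subseteq> E - L"
        by (auto simp: glues_def)
      moreover have "C \<subseteq> E"
        using C saturated_component[OF E] unfolding components_def by blast
      ultimately show ?thesis by blast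
    qed
  qed
  have "(\<Sum>D\<in>{D \<in> fst X. D \<subseteq> E - L}. snd X D) = (\<Sum>C\<in>?K. snd X (C - L))"
    by (rule sum.reindex_bij_betw[OF bij, symmetric])
  also have "\<dots> = (\<Sum>C\<in>?K. weight L F C)"
    using X live by (intro sum.cong refl) (auto simp: glues_def)
  also have "\<dots> = weight L F E"
    by (rule weight_sum_components[OF finF neF LF saturated_component[OF E]])
  finally have 1: "(\<Sum>D\<in>{D \<in> fst X. D \<subseteq> E - L}. snd X D) = weight L F E" .
  have 2: "(\<Sum>Y\<leftarrow>G. \<Sum>A\<in>{A \<in> fst Y. A \<subseteq> E - L}. snd Y A) =
      (\<Sum>Y\<leftarrow>G. \<Sum>A\<in>{A \<in> fst Y. A \<subseteq> E}. snd Y A)"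
    using LG by (intro arg_cong[of _ _ sum_list] map_cong refl sum.cong) (auto simp: pieces_def)
  have "finite E"
    by (rule finite_subset[of _ "\<Union>(pieces F) \<union> \<Union>(pieces G)"])
      (use E finF finG in \<open>auto simp: components_def pieces_append\<close>)
  then have "card (E \<inter> L \<union> (E - L) \<inter> M) = card (E \<inter> L) + card ((E - L) \<inter> M)"
    by (intro card_Un_disjoint) auto
  moreover have "E \<inter> L \<union> (E - L) \<inter> M = E \<inter> (L \<union> M)" using LM by blast
  ultimately have 3: "card (E \<inter> (L \<union> M)) = card (E \<inter> L) + card ((E - L) \<inter> M)" by simp
  show ?thesis
    using 1 2 3 by (simp add: weight_def)
qed

lemma glues_assoc:
  assumes Y: "glues M (X # G) Y"
  shows "glues (L \<union> M) (F @ G) Y"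
proof -
  have minus: "E - (L \<union> M) = E - L - M" for E by blast
  have "(\<lambda>D. D - M) ` (\<X> - {{}}) - {{}} = (\<lambda>D. D - M) ` \<X> - {{}}" for \<X>
    by auto
  then have "fst Y = (\<lambda>E. E - (L \<union> M)) ` components (pieces (F @ G)) - {{}}"
    using Y by (simp add: glues_def components_second_step image_image minus)
  moreover have "snd Y (E - (L \<union> M)) = weight (L \<union> M) (F @ G) E"
    if E: "E \<in> components (pieces (F @ G))" and "\<not> E \<subseteq> L \<union> M" for E
  proof -
    have EL: "\<not> E \<subseteq> L" "\<not> E - L \<subseteq> M" using that by blast+
    with E have "E - L \<in> components (pieces (X # G))"
      unfolding components_second_step by blast
    moreover from Y have "snd Y (D - M) = weight M (X # G) D"
      if "D \<in> components (pieces (X # G))" "\<not> D \<subseteq> M" for D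
      using that by (simp add: glues_def)
    ultimately have "snd Y (E - L - M) = weight M (X # G) (E - L)"
      using EL(2) by blast
    with weight_second_step[OF E EL(1)] show ?thesis by (simp add: minus)
  qed
  ultimately show ?thesis by (simp add: glues_def)
qed

text \<open>A component inside \<open>L \<union> M\<close> either lies inside \<open>L\<close> and dies in the first step, or survives the
  first step and dies in the second.\<close>

lemma dead_count_assoc:
  "dead_count L F w + dead_count M (X # G) w = dead_count (L \<union> M) (F @ G) w"
proof -
  let ?All = "{E \<in> components (pieces (F @ G)). E \<subseteq> L \<union> M \<and> weight (L \<union> M) (F @ G) E = w}"
  let ?A = "{E \<in> ?All. E \<subseteq> L}" and ?B = "{E \<in> ?All. \<not> E \<subseteq> L}"
  have fin: "finite ?All"
    using finF finG finite_components[of "pieces (F @ G)"] by (simp add: pieces_append)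
  have "weight (L \<union> M) (F @ G) E = weight L F E"
    if E: "E \<subseteq> L" for E
  proof -
    have no: "{A \<in> fst Y. A \<subseteq> E} = {}" if "Y \<in> set G" for Y
    proof -
      have "A = {}" if "A \<in> fst Y" "A \<subseteq> E" for A
      proof -
        have "A \<subseteq> \<Union>(pieces G)" using that \<open>Y \<in> set G\<close> by (auto simp: pieces_def)
        with that E LG show ?thesis by blast
      qed
      moreover have "{} \<notin> fst Y" using neG that by (auto simp: pieces_def)
      ultimately show ?thesis by blast
    qed
    have "(\<Sum>Y\<leftarrow>G. \<Sum>A\<in>{A \<in> fst Y. A \<subseteq> E}. snd Y A) = (\<Sum>Y\<leftarrow>G. 0)"
      by (intro arg_cong[of _ _ sum_list] map_cong refl) (simp only: no sum.empty)
    moreover have "E \<inter> (L \<union> M) = E \<inter> L" using E by blast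
    ultimately show ?thesis by (simp add: weight_def)
  qed
  then have "?A = {C \<in> components (pieces F). C \<subseteq> L \<and> weight L F C = w}"
    using components_inside_L by auto
  then have A: "card ?A = dead_count L F w" by (simp add: dead_count_def)
  have "bij_betw (\<lambda>E. E - L) ?B {D \<in> components (pieces (X # G)). D \<subseteq> M \<and> weight M (X # G) D = w}"
  proof (rule bij_betwI')
    show "E - L = E' - L \<longleftrightarrow> E = E'" if "E \<in> ?B" "E' \<in> ?B" for E E'
      using that diff_inj[of E "pieces (F @ G)" E'] by blast
    show "E - L \<in> {D \<in> components (pieces (X # G)). D \<subseteq> M \<and> weight M (X # G) D = w}"
      if "E \<in> ?B" for E
      using that weight_second_step[of E] unfolding components_second_step by auto
    show "\<exists>E\<in>?B. D = E - L"
      if D: "D \<in> {D \<in> components (pieces (X # G)). D \<subseteq> M \<and> weight M (X # G) D = w}" for D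
    proof -
      from D obtain E where E: "E \<in> components (pieces (F @ G))" "D = E - L" "\<not> E \<subseteq> L"
        unfolding components_second_step by blast
      with D weight_second_step[of E] show ?thesis by auto
    qed
  qed
  then have B: "card ?B = dead_count M (X # G) w"
    by (simp only: dead_count_def bij_betw_same_card)
  have "?All = ?A \<union> ?B" by blast
  then have "card ?All = card ?A + card ?B"
    using fin by (metis (no_types, lifting) card_Un_disjoint finite_Un disjoint_iff mem_Collect_eq)
  then show ?thesis by (simp only: A B dead_count_def[of "L \<union> M"])
qed

end

section \<open>Composition of arrows as gluing\<close>

text \<open>The shift by \<open>1\<close> converts the labels of an arrow into additive ones.\<close>

definition embed :: "('y \<Rightarrow> 'x) \<Rightarrow> 'y lpart \<Rightarrow> 'x lpart" where
  "embed e = (\<lambda>(\<alpha>, g). ((`) e ` \<alpha>, \<lambda>S. g (e -` S) - 1))"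

lemma inj_embs: "inj emb12" "inj emb23" "inj emb13"
  by (auto simp: emb12_def emb23_def emb13_def inj_on_def map_sum_def split: sum.splits)

lemma inj_image_fun: "inj e \<Longrightarrow> inj ((`) e)"
  by (simp add: inj_def inj_image_eq_iff)

lemma sum_pieces_embed:
  assumes "inj e" "finite \<alpha>"
  shows "(\<Sum>A\<in>{A \<in> fst (embed e (\<alpha>, g)). A \<subseteq> T}. snd (embed e (\<alpha>, g)) A) =
    (\<Sum>A\<in>{A \<in> \<alpha>. e ` A \<subseteq> T}. g A) - int (card {A \<in> \<alpha>. e ` A \<subseteq> T})"
proof -
  have "{A \<in> (`) e ` \<alpha>. A \<subseteq> T} = (`) e ` {A \<in> \<alpha>. e ` A \<subseteq> T}" by blast
  moreover have "inj_on ((`) e) B" for B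
    using inj_image_fun[OF assms(1)] by (rule inj_on_subset) simp
  ultimately show ?thesis
    using assms by (simp add: embed_def sum.reindex card_image inj_vimage_image_eq sum_subtractf)
qed

context
  fixes l m n :: nat and \<alpha> \<beta> :: "(nat + nat) set set"
  assumes \<alpha>: "is_partition l m \<alpha>" and \<beta>: "is_partition m n \<beta>"
begin

lemma finite_partitions: "finite \<alpha>" "finite \<beta>"
  using \<alpha> \<beta> finite_elements[of "interval l <+> interval m" \<alpha>]
    finite_elements[of "interval m <+> interval n" \<beta>] by (simp_all add: is_partition_def)

lemma gen_partition_eq_components:
  "gen_partition l m n \<alpha> \<beta> = components ((`) emb12 ` \<alpha> \<union> (`) emb23 ` \<beta>)"
proof -
  let ?\<S> = "(`) emb12 ` \<alpha> \<union> (`) emb23 ` \<beta>"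
  have "\<Union>\<alpha> = interval l <+> interval m" "\<Union>\<beta> = interval m <+> interval n"
    using \<alpha> \<beta> by (simp_all add: is_partition_def partition_on_def)
  moreover have "\<Union>?\<S> = emb12 ` \<Union>\<alpha> \<union> emb23 ` \<Union>\<beta>" by blast
  ultimately have "\<Union>?\<S> = triple_sum l m n"
    by (auto simp: triple_sum_def emb12_def emb23_def Plus_def image_Un image_image)
  moreover have "gen_rel \<alpha> \<beta> = (\<Union>S\<in>?\<S>. S \<times> S)\<^sup>+"
    by (simp add: gen_rel_def)
  ultimately show ?thesis
    unfolding gen_partition_def components_eq_quotient by simp
qed

lemma gen_partition_subset: "C \<in> gen_partition l m n \<alpha> \<beta> \<Longrightarrow> C \<subseteq> triple_sum l m n"
  using equiv_gen_rel[OF \<alpha> \<beta>] unfolding gen_partition_def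
  by (meson in_quotient_imp_subset)

text \<open>Restricting a block to the outer components amounts to deleting its middle points.\<close>

lemma outer_part:
  assumes "C \<in> gen_partition l m n \<alpha> \<beta>"
  shows "emb13 ` (emb13 -` C) = C - middle m"
proof -
  have "x \<in> range emb13 \<longleftrightarrow> x \<notin> middle m" if "x \<in> triple_sum l m n" for x
    using that unfolding triple_sum_def middle_def emb13_def
    by (auto simp: image_iff split_sum_ex)
  then show ?thesis
    using gen_partition_subset[OF assms] by (auto simp: image_vimage_eq)
qed

context
  fixes j :: "nat + nat + nat \<Rightarrow> 'x" and g h :: "(nat + nat) set \<Rightarrow> int"
  assumes j: "inj j"
begin

text \<open>The map \<open>j\<close> places the triple disjoint union inside a larger space. This freedom is needed to
  view all four composites of the associativity law within one fourfold disjoint union.\<close>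

abbreviation "factors \<equiv> [embed (j \<circ> emb12) (\<alpha>, g), embed (j \<circ> emb23) (\<beta>, h)]"

lemma components_factors: "components (pieces factors) = (`) j ` gen_partition l m n \<alpha> \<beta>"
proof -
  have "pieces factors = (`) j ` ((`) emb12 ` \<alpha> \<union> (`) emb23 ` \<beta>)"
    by (simp add: pieces_def embed_def image_Un image_image)
  then show ?thesis
    by (simp only: components_image[OF j] gen_partition_eq_components)
qed

lemma weight_factors: "weight (j ` middle m) factors (j ` C) = block_label m \<alpha> g \<beta> h C - 1"
proof -
  have inj: "inj (j \<circ> emb12)" "inj (j \<circ> emb23)"
    using j inj_embs by (auto intro: inj_compose)
  have "(j \<circ> e) ` A \<subseteq> j ` C \<longleftrightarrow> e ` A \<subseteq> C" for e :: "nat + nat \<Rightarrow> _" and A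
    by (simp only: image_comp[symmetric] inj_image_subset_iff[OF j])
  moreover have "card (j ` C \<inter> j ` middle m) = card (C \<inter> middle m)"
    using j by (metis card_image image_Int inj_on_subset subset_UNIV)
  ultimately show ?thesis
    unfolding weight_def block_label_def
    by (simp add: sum_pieces_embed[OF inj(1) finite_partitions(1)]
        sum_pieces_embed[OF inj(2) finite_partitions(2)] Let_def del: comp_apply)
qed

lemma g_comp_eq_block_label:
  assumes C: "C \<in> gen_partition l m n \<alpha> \<beta>" and ne: "\<not> C \<subseteq> middle m"
  shows "g_comp l m n \<alpha> g \<beta> h (emb13 -` C) = block_label m \<alpha> g \<beta> h C"
proof -
  have D: "emb13 -` C \<noteq> {}" using outer_part[OF C] ne by blast
  then have "(THE C'. C' \<in> gen_partition l m n \<alpha> \<beta> \<and> emb13 ` (emb13 -` C) \<subseteq> C') = C"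
    using C components_disjoint[of C] unfolding gen_partition_eq_components
    by (intro the_equality) (blast | fast)+
  moreover have "emb13 -` C \<in> part_prod l m n \<alpha> \<beta>"
    using C D by (simp add: part_prod_def)
  ultimately show ?thesis by (simp add: g_comp_def)
qed

lemma glues_factors:
  "glues (j ` middle m) factors
     (embed (j \<circ> emb13) (part_prod l m n \<alpha> \<beta>, g_comp l m n \<alpha> g \<beta> h))"
proof -
  have hide: "j ` C - j ` middle m = (j \<circ> emb13) ` (emb13 -` C)"
    if "C \<in> gen_partition l m n \<alpha> \<beta>" for C
    by (simp only: image_comp[symmetric] outer_part[OF that] image_set_diff[OF j])
  have "(`) (j \<circ> emb13) ` part_prod l m n \<alpha> \<beta> =
      (\<lambda>C. (j \<circ> emb13) ` (emb13 -` C)) ` gen_partition l m n \<alpha> \<beta> - {{}}"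
    unfolding part_prod_def by blast
  also have "\<dots> = (\<lambda>C. j ` C - j ` middle m) ` gen_partition l m n \<alpha> \<beta> - {{}}"
    using hide by (simp cong: image_cong)
  finally have blocks: "(`) (j \<circ> emb13) ` part_prod l m n \<alpha> \<beta> =
    (\<lambda>C. C - j ` middle m) ` (`) j ` gen_partition l m n \<alpha> \<beta> - {{}}"
    by (simp add: image_image)
  have inj: "inj (j \<circ> emb13)" using j inj_embs by (auto intro: inj_compose)
  have "g_comp l m n \<alpha> g \<beta> h ((j \<circ> emb13) -` (j ` C - j ` middle m)) - 1 =
      weight (j ` middle m) factors (j ` C)"
    if C: "C \<in> gen_partition l m n \<alpha> \<beta>" and "\<not> j ` C \<subseteq> j ` middle m" for C
  proof -
    have "\<not> C \<subseteq> middle m" using that by blast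
    then show ?thesis
      unfolding hide[OF C] inj_vimage_image_eq[OF inj] weight_factors
      by (simp add: g_comp_eq_block_label[OF C])
  qed
  then show ?thesis
    unfolding glues_def components_factors
    using blocks by (simp add: embed_def)
qed

lemma b_comp_eq_dead_count:
  "Poly_Mapping.lookup (b_comp l m n \<alpha> g \<beta> h) i = int (dead_count (j ` middle m) factors (i - 1))"
proof -
  have "{E \<in> (`) j ` gen_partition l m n \<alpha> \<beta>.
        E \<subseteq> j ` middle m \<and> weight (j ` middle m) factors E = i - 1} =
      (`) j ` {C \<in> dead_blocks l m n \<alpha> \<beta>. block_label m \<alpha> g \<beta> h C = i}"
    using inj_image_subset_iff[OF j] by (auto simp: dead_blocks_def weight_factors)
  moreover have "inj_on ((`) j) B" for B
    using inj_image_fun[OF j] by (rule inj_on_subset) simp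
  ultimately show ?thesis
    unfolding dead_count_def components_factors by (simp add: b_comp.rep_eq card_image)
qed

end

end

section \<open>Associativity\<close>

lemma glues_permute: "glues V [X, Y] = glues V [Y, X]"
  "glues V [X, Y, Z] = glues V [Y, Z, X]"
  by (auto simp: glues_def weight_def pieces_def Un_ac fun_eq_iff)

lemma dead_count_permute: "dead_count V [X, Y] = dead_count V [Y, X]"
  "dead_count V [X, Y, Z] = dead_count V [Y, Z, X]"
  by (auto simp: dead_count_def weight_def pieces_def Un_ac fun_eq_iff ac_simps)

lemma glues_unique:
  assumes "inj e" "glues V F (embed e (\<alpha>, g))" "glues V F (embed e (\<beta>, h))"
  shows "\<alpha> = \<beta>" and "D \<in> \<alpha> \<Longrightarrow> g D = h D"
proof -
  have "(`) e ` \<alpha> = (`) e ` \<beta>" using assms by (simp add: glues_def embed_def)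
  then show "\<alpha> = \<beta>"
    by (simp add: inj_image_eq_iff inj_image_fun[OF assms(1)])
  assume "D \<in> \<alpha>"
  then have "e ` D \<in> (\<lambda>C. C - V) ` components (pieces F) - {{}}"
    using assms(2) by (auto simp: glues_def embed_def)
  then obtain C where "C \<in> components (pieces F)" "\<not> C \<subseteq> V" and D: "e ` D = C - V" by blast
  then have "snd Z (C - V) = weight V F C" if "glues V F Z" for Z
    using that by (simp add: glues_def)
  from this[OF assms(2)] this[OF assms(3)]
  have "snd (embed e (\<alpha>, g)) (e ` D) = snd (embed e (\<beta>, h)) (e ` D)"
    by (simp add: D)
  then show "g D = h D"
    using assms(1) by (simp add: embed_def inj_vimage_image_eq)
qed

theorem proposition2p4:
  fixes k l m n :: nat and f1 f2 f3 :: arrow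
  assumes "f1 \<in> Hom k l" and "f2 \<in> Hom l m" and "f3 \<in> Hom m n"
  shows "cob_comp k m n (cob_comp k l m f1 f2) f3 = cob_comp k l n f1 (cob_comp l m n f2 f3)"
proof -
  obtain \<alpha> g s \<beta> h t \<gamma> q u where f: "f1 = (\<alpha>, g, s)" "f2 = (\<beta>, h, t)" "f3 = (\<gamma>, q, u)"
    by (cases f1, cases f2, cases f3) auto
  obtain \<alpha>\<beta> gh where ab: "\<alpha>\<beta> = part_prod k l m \<alpha> \<beta>" "gh = g_comp k l m \<alpha> g \<beta> h" by blast
  obtain \<beta>\<gamma> hq where bc: "\<beta>\<gamma> = part_prod l m n \<beta> \<gamma>" "hq = g_comp l m n \<beta> h \<gamma> q" by blast
  have p: "is_partition k l \<alpha>" "is_partition l m \<beta>" "is_partition m n \<gamma>"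
    using assms by (auto simp: f Hom_def)
  have p_ab: "is_partition k m \<alpha>\<beta>" and p_bc: "is_partition l n \<beta>\<gamma>"
    using cob_comp_in_Hom[OF assms(1,2)] cob_comp_in_Hom[OF assms(2,3)]
    by (simp_all add: f ab bc cob_comp_def Hom_def)

  \<comment> \<open>The four composites live on the four threefold unions inside the fourfold one. The inclusions
    of two components obtained through different threefold unions agree.\<close>
  define klm :: "nat + nat + nat \<Rightarrow> nat + nat + nat + nat" where "klm = map_sum id (map_sum id Inl)"
  define kmn :: "nat + nat + nat \<Rightarrow> nat + nat + nat + nat" where "kmn = map_sum id Inr"
  define lmn :: "nat + nat + nat \<Rightarrow> nat + nat + nat + nat" where "lmn = Inr"
  define kln :: "nat + nat + nat \<Rightarrow> nat + nat + nat + nat" where "kln = map_sum id (map_sum id Inr)"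
  note js = klm_def kmn_def lmn_def kln_def
  note embs = emb12_def emb23_def emb13_def
  have inj: "inj klm" "inj kmn" "inj lmn" "inj kln"
    by (auto simp: js inj_on_def map_sum_def split: sum.splits)
  define kl where "kl = klm \<circ> emb12"
  define lm where "lm = klm \<circ> emb23"
  define mn where "mn = kmn \<circ> emb23"
  define kn where "kn = kmn \<circ> emb13"
  note es = kl_def lm_def mn_def kn_def
  have agree: "kln \<circ> emb12 = kl" "lmn \<circ> emb12 = lm" "lmn \<circ> emb23 = mn" "kln \<circ> emb13 = kn"
    "kmn \<circ> emb12 = klm \<circ> emb13" "kln \<circ> emb23 = lmn \<circ> emb13"
    by (auto simp: es js embs fun_eq_iff map_sum_def split: sum.splits)
  have inj_kn: "inj kn" using inj inj_embs unfolding kn_def by (blast intro: inj_compose)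

  define L where "L = klm ` middle l"
  define M where "M = kmn ` middle m"
  have L: "kln ` middle l = L" and M: "lmn ` middle m = M"
    by (auto simp: L_def M_def js middle_def image_image)

  let ?P = "embed kl (\<alpha>, g)" and ?Q = "embed lm (\<beta>, h)" and ?R = "embed mn (\<gamma>, q)"
  let ?X = "embed (klm \<circ> emb13) (\<alpha>\<beta>, gh)" and ?Y = "embed (lmn \<circ> emb13) (\<beta>\<gamma>, hq)"
  let ?gl = "g_comp k m n \<alpha>\<beta> gh \<gamma> q" and ?gr = "g_comp k l n \<alpha> g \<beta>\<gamma> hq"
  let ?pl = "part_prod k m n \<alpha>\<beta> \<gamma>" and ?pr = "part_prod k l n \<alpha> \<beta>\<gamma>"

  have X: "glues L [?P, ?Q] ?X" and Xd: "Poly_Mapping.lookup (b_comp k l m \<alpha> g \<beta> h) i = int (dead_count L [?P, ?Q] (i - 1))"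
    and Zl: "glues M [?X, ?R] (embed kn (?pl, ?gl))"
    and Zld: "Poly_Mapping.lookup (b_comp k m n \<alpha>\<beta> gh \<gamma> q) i = int (dead_count M [?X, ?R] (i - 1))"
    and Y: "glues M [?Q, ?R] ?Y" and Yd: "Poly_Mapping.lookup (b_comp l m n \<beta> h \<gamma> q) i = int (dead_count M [?Q, ?R] (i - 1))"
    and Zr: "glues L [?P, ?Y] (embed kn (?pr, ?gr))"
    and Zrd: "Poly_Mapping.lookup (b_comp k l n \<alpha> g \<beta>\<gamma> hq) i = int (dead_count L [?P, ?Y] (i - 1))" for i
    using glues_factors[OF p(1,2) inj(1), of g h] b_comp_eq_dead_count[OF p(1,2) inj(1), of g h]
      glues_factors[OF p_ab p(3) inj(2), of gh q] b_comp_eq_dead_count[OF p_ab p(3) inj(2), of gh q]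
      glues_factors[OF p(2,3) inj(3), of h q] b_comp_eq_dead_count[OF p(2,3) inj(3), of h q]
      glues_factors[OF p(1) p_bc inj(4), of g hq] b_comp_eq_dead_count[OF p(1) p_bc inj(4), of g hq]
    unfolding agree L M kl_def[symmetric] lm_def[symmetric] mn_def[symmetric] kn_def[symmetric]
      L_def[symmetric] M_def[symmetric] ab[symmetric] bc[symmetric]
    by this+

  have U: "\<Union>\<alpha> = interval k <+> interval l" "\<Union>\<beta> = interval l <+> interval m"
    "\<Union>\<gamma> = interval m <+> interval n" and ne: "{} \<notin> \<alpha>" "{} \<notin> \<beta>" "{} \<notin> \<gamma>"
    using p by (auto simp: is_partition_def partition_on_def)
  have pcs: "pieces (embed e (\<delta>, d) # F) = (`) e ` \<delta> \<union> pieces F" "pieces [] = {}"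
    for e :: "nat + nat \<Rightarrow> nat + nat + nat + nat" and \<delta> d F
    by (simp_all add: pieces_def embed_def)
  have Un_image: "\<Union>((`) e ` \<delta>) = e ` \<Union>\<delta>" for e :: "nat + nat \<Rightarrow> nat + nat + nat + nat" and \<delta>
    by blast
  have LM: "L \<subseteq> kl ` \<Union>\<alpha>" "M \<subseteq> mn ` \<Union>\<gamma>" "L \<inter> mn ` \<Union>\<gamma> = {}" "M \<inter> kl ` \<Union>\<alpha> = {}" "L \<inter> M = {}"
  proof -
    have "L = kl ` Inr ` interval l" "M = mn ` Inl ` interval m"
      by (auto simp: L_def M_def es js embs middle_def image_image)
    then show "L \<subseteq> kl ` \<Union>\<alpha>" "M \<subseteq> mn ` \<Union>\<gamma>"
      unfolding U by (auto simp: Plus_def)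
  qed (auto simp: U L_def M_def es js embs middle_def)
  have "glued_twice L M [?P, ?Q] [?R] ?X"
    by unfold_locales (use X LM ne in \<open>auto simp: pcs Un_image U\<close>)
  then interpret left: glued_twice L M "[?P, ?Q]" "[?R]" ?X .
  \<comment> \<open>The other bracketing hides \<open>M\<close> first, so it is the same situation with the factors in the
    order second, third, first.\<close>
  have "glued_twice M L [?Q, ?R] [?P] ?Y"
    by unfold_locales (use Y LM ne in \<open>auto simp: pcs Un_image U\<close>)
  then interpret right: glued_twice M L "[?Q, ?R]" "[?P]" ?Y .

  have l: "glues (L \<union> M) [?P, ?Q, ?R] (embed kn (?pl, ?gl))"
    using left.glues_assoc[OF Zl] by simp
  have r: "glues (L \<union> M) [?P, ?Q, ?R] (embed kn (?pr, ?gr))"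
    using right.glues_assoc[of "embed kn (?pr, ?gr)"] Zr
    by (simp add: glues_permute(1)[of _ ?P] glues_permute(2)[of _ ?P] Un_commute)
  note parts = glues_unique(1)[OF inj_kn l r] and labels = glues_unique(2)[OF inj_kn l r]
  \<comment> \<open>Off the blocks, both labellings take the value \<^const>\<open>undefined\<close>.\<close>
  have "?gl = ?gr"
  proof
    fix D show "?gl D = ?gr D"
    proof (cases "D \<in> ?pl")
      case False
      moreover from this have "D \<notin> ?pr" using parts by simp
      ultimately show ?thesis by (simp add: g_comp_def)
    qed (rule labels)
  qed
  moreover have "b_comp k l m \<alpha> g \<beta> h + b_comp k m n \<alpha>\<beta> gh \<gamma> q =
      b_comp l m n \<beta> h \<gamma> q + b_comp k l n \<alpha> g \<beta>\<gamma> hq"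
  proof (rule poly_mapping_eqI)
    fix i
    have "dead_count L [?P, ?Q] w + dead_count M [?X, ?R] w =
        dead_count M [?Q, ?R] w + dead_count L [?P, ?Y] w" for w
      using left.dead_count_assoc[of w] right.dead_count_assoc[of w]
      by (simp add: dead_count_permute(1)[of _ ?P] dead_count_permute(2)[of _ ?P] Un_commute)
    then show "Poly_Mapping.lookup (b_comp k l m \<alpha> g \<beta> h + b_comp k m n \<alpha>\<beta> gh \<gamma> q) i =
        Poly_Mapping.lookup (b_comp l m n \<beta> h \<gamma> q + b_comp k l n \<alpha> g \<beta>\<gamma> hq) i"
      by (simp only: lookup_add Xd Yd Zld Zrd of_nat_add[symmetric])
  qed
  ultimately show ?thesis
    using parts by (simp add: f cob_comp_def ab[symmetric] bc[symmetric] algebra_simps)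
qed

end
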